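(* Let $n,k$ be integers with $1\leq k\leq n$, and let $P_n^k$ be the $k$-th power of the $n$-path, i.e. the graph with vertex set $[n]=\{1,2,\ldots,n\}$ in which $a,b\in[n]$ are joined by an edge if and only if $1\leq |a-b|\leq k$. Then $P_n^k$ is $r$-EKR for all integers $r\geq 1$.
   Context: An independent set in a graph $G=(V,E)$ is a subset of $V$ not containing any edge of $G$. For an integer $r\geq 1$, $\mathcal{I}^{(r)}(G)=\{A\subseteq V(G) : |A|=r \text{ and } A \text{ is an independent set}\}$. For $v\in V(G)$, the star at $v$ is $\mathcal{I}_v^{(r)}(G)=\{A\in \mathcal{I}^{(r)}(G): v\in A\}$. A family of sets is intersecting if any two of its members have non-empty intersection. A graph $G$ is $r$-EKR if no intersecting family $\mathcal{A}\subseteq\mathcal{I}^{(r)}(G)$ is larger than the largest star, i.e. every intersecting $\mathcal{A}\subseteq\mathcal{I}^{(r)}(G)$ satisfies $|\mathcal{A}|\leq \max_{v\in V(G)}|\mathcal{I}_v^{(r)}(G)|$. *)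

theory Defs
  imports Main
begin

text \<open>
  A graph is a pair of a vertex set and a set of edges, an edge being a two-element set of vertices.
\<close>

type_synonym 'a graph = "'a set \<times> 'a set set"

abbreviation verts :: "'a graph \<Rightarrow> 'a set" where
  "verts G \<equiv> fst G"

abbreviation edges :: "'a graph \<Rightarrow> 'a set set" where
  "edges G \<equiv> snd G"

definition independent_set :: "'a graph \<Rightarrow> 'a set \<Rightarrow> bool" where
  "independent_set G A \<longleftrightarrow> A \<subseteq> verts G \<and> (\<forall>e\<in>edges G. \<not> e \<subseteq> A)"

definition indep_sets :: "'a graph \<Rightarrow> nat \<Rightarrow> 'a set set" where
  "indep_sets G r = {A. A \<subseteq> verts G \<and> card A = r \<and> independent_set G A}"

definition star :: "'a graph \<Rightarrow> nat \<Rightarrow> 'a \<Rightarrow> 'a set set" where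
  "star G r v = {A \<in> indep_sets G r. v \<in> A}"

definition intersecting :: "'a set set \<Rightarrow> bool" where
  "intersecting \<F> \<longleftrightarrow> (\<forall>A\<in>\<F>. \<forall>B\<in>\<F>. A \<inter> B \<noteq> {})"

text \<open>
  The use of \<open>card\<close> and \<open>Max\<close> is meaningful for graphs with a finite non-empty vertex set.
\<close>

definition EKR :: "nat \<Rightarrow> 'a graph \<Rightarrow> bool" where
  "EKR r G \<longleftrightarrow>
     (\<forall>\<F>. \<F> \<subseteq> indep_sets G r \<and> intersecting \<F> \<longrightarrow>
        card \<F> \<le> Max ((\<lambda>v. card (star G r v)) ` verts G))"

text \<open>
  Differences of labels are taken in the integers, since subtraction on \<open>nat\<close> is truncated.
\<close>

definition path_power :: "nat \<Rightarrow> nat \<Rightarrow> nat graph" where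
  "path_power n k =
     ({1..n},
      {{a, b} | a b. a \<in> {1..n} \<and> b \<in> {1..n} \<and>
         1 \<le> \<bar>int a - int b\<bar> \<and> \<bar>int a - int b\<bar> \<le> int k})"

lemma path_power_adjacent_iff:
  assumes "a \<in> {1..n}" and "b \<in> {1..n}"
  shows "{a, b} \<in> edges (path_power n k) \<longleftrightarrow>
    1 \<le> \<bar>int a - int b\<bar> \<and> \<bar>int a - int b\<bar> \<le> int k"
  using assms unfolding path_power_def
  by (auto simp: doubleton_eq_iff abs_minus_commute)

end

theory Submission
  imports Defs
begin

text \<open>
  The end vertex \<open>n\<close> carries a largest star. Contract the first two vertices \<open>l\<close> and \<open>Suc l\<close> of a
  path on \<open>{l..n}\<close>: a member of an intersecting family \<open>F\<close> stays independent unless it contains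
  both \<open>l\<close> and \<open>l + k + 1\<close>, and two members are identified only if they are \<open>insert l X\<close> and
  \<open>insert (Suc l) X\<close>. The remaining independent images form an intersecting family on \<open>{Suc l..n}\<close>.
  The lost sets with \<open>l\<close> removed, together with the sets \<open>X\<close>, form an intersecting family of
  \<open>(r - 1)\<close>-sets on \<open>{l + k + 1..n}\<close>. The star at \<open>n\<close> satisfies the same recursion exactly,
  according to whether its members contain \<open>l\<close>.
\<close>

text \<open>These are the independent \<open>r\<close>-sets of the subgraph of the path power
  induced on \<open>{l..n}\<close>. The left end is a parameter because the induction shortens the
  path from the left, while \<open>n\<close> stays fixed. The ordered form of separation avoids
  absolute values and subtraction.\<close>

definition separated_sets :: "nat \<Rightarrow> nat \<Rightarrow> nat \<Rightarrow> nat \<Rightarrow> nat set set" where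
  "separated_sets k n l r =
     {A. A \<subseteq> {l..n} \<and> card A = r \<and> (\<forall>a\<in>A. \<forall>b\<in>A. a < b \<longrightarrow> a + k < b)}"

lemma finite_separated_sets [simp]: "finite (separated_sets k n l r)"
  by (rule finite_subset[of _ "Pow {l..n}"]) (auto simp: separated_sets_def)

lemma separated_sets_sep:
  assumes "A \<in> separated_sets k n l r" "a \<in> A" "b \<in> A" "a < b"
  shows "a + k < b"
  using assms unfolding separated_sets_def by blast

lemma separated_sets_subset: "A \<in> separated_sets k n l r \<Longrightarrow> A \<subseteq> {l..n}"
  by (simp add: separated_sets_def)

lemma separated_sets_card: "A \<in> separated_sets k n l r \<Longrightarrow> card A = r"
  by (simp add: separated_sets_def)

text \<open>All other members lie to the right of the left end \<open>l\<close>, hence beyond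
  \<open>l + k\<close>.\<close>

lemma separated_sets_remove_first:
  assumes A: "A \<in> separated_sets k n l (Suc r)" and l: "l \<in> A"
  shows "A - {l} \<in> separated_sets k n (l + k + 1) r"
proof -
  have "l + k < x" if "x \<in> A" "x \<noteq> l" for x
    using separated_sets_sep[OF A l that(1)] separated_sets_subset[OF A] that by force
  moreover have "card (A - {l}) = r"
    using separated_sets_card[OF A] l by simp
  moreover have "x \<le> n" if "x \<in> A" for x
    using separated_sets_subset[OF A] that by auto
  moreover have "\<forall>a\<in>A - {l}. \<forall>b\<in>A - {l}. a < b \<longrightarrow> a + k < b"
    using separated_sets_sep[OF A] by blast
  ultimately show ?thesis
    by (simp add: separated_sets_def subset_iff Suc_le_eq)
qed

lemma separated_sets_insert_first:
  assumes A: "A \<in> separated_sets k n (l + k + 1) r" and "l \<le> n"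
  shows "insert l A \<in> separated_sets k n l (Suc r)"
proof -
  have sub: "A \<subseteq> {l + k + 1..n}" using separated_sets_subset[OF A] .
  then have "l \<notin> A" "finite A" by (auto intro: finite_subset)
  moreover have "a + k < b" if "a \<in> insert l A" "b \<in> insert l A" "a < b" for a b
    using that sub separated_sets_sep[OF A, of a b] by auto
  moreover have "insert l A \<subseteq> {l..n}" using sub \<open>l \<le> n\<close> by auto
  ultimately show ?thesis
    using separated_sets_card[OF A] by (simp add: separated_sets_def)
qed

lemma separated_sets_mono: "l' \<le> l \<Longrightarrow> separated_sets k n l r \<subseteq> separated_sets k n l' r"
  using atLeastatMost_subset_iff[of l n l' n] unfolding separated_sets_def by blast

text \<open>The first family embeds by inclusion and the second by inserting \<open>l\<close>; the
  images are disjoint since only the latter contain \<open>l\<close>.\<close>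

lemma star_recursion:
  assumes "l \<le> n"
  shows "card {A \<in> separated_sets k n (Suc l) (Suc r). n \<in> A}
       + card {A \<in> separated_sets k n (l + k + 1) r. n \<in> A}
       \<le> card {A \<in> separated_sets k n l (Suc r). n \<in> A}" (is "card ?P + card ?Q \<le> card ?R")
proof -
  have "inj_on (insert l) ?Q"
    by (rule inj_on_inverseI[where g = "\<lambda>A. A - {l}"]) (auto simp: separated_sets_def)
  then have "card ?P + card ?Q = card ?P + card (insert l ` ?Q)"
    by (simp add: card_image)
  also have "\<dots> = card (?P \<union> insert l ` ?Q)"
    by (subst card_Un_disjoint) (auto simp: separated_sets_def)
  also have "\<dots> \<le> card ?R"
    using separated_sets_insert_first[OF _ assms] separated_sets_mono[of l "Suc l" k n "Suc r"]
    by (intro card_mono) auto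
  finally show ?thesis .
qed

text \<open>\<open>B\<close> holds the surviving images, \<open>C\<close> pays for losses
  \<open>D\<close> and collisions \<open>M\<close>. The count combines
  \<open>|F| = |E0| + |E1| + |D|\<close>, \<open>|E0| + |E1| = |B| + |M|\<close> and
  \<open>|C| = |M| + |D|\<close>.\<close>

lemma contraction_bound:
  assumes k: "1 \<le> k" and l: "l < n" and F: "F \<subseteq> separated_sets k n l (Suc r)" and int: "intersecting F"
  obtains B C where "B \<subseteq> separated_sets k n (Suc l) (Suc r)" "intersecting B"
    "C \<subseteq> separated_sets k n (l + k + 1) r" "intersecting C" "card F = card B + card C"
proof -
  define g where "g = (\<lambda>x. if x = l then Suc l else x)"
  \<comment> \<open>Moving \<open>l\<close> to \<open>Suc l\<close> can break separation only
    against \<open>l + k + 1\<close>, so \<open>D\<close> collects the members whose image is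
    lost.\<close>
  define D where "D = {A \<in> F. l \<in> A \<and> l + k + 1 \<in> A}"
  define E0 where "E0 = {A \<in> F. l \<notin> A}"
  define E1 where "E1 = {A \<in> F. l \<in> A \<and> l + k + 1 \<notin> A}"
  define M where "M = E0 \<inter> image g ` E1"
  define B where "B = E0 \<union> image g ` E1"
  define C where "C = (\<lambda>A. A - {Suc l}) ` M \<union> (\<lambda>A. A - {l}) ` D"
  have fin: "finite F" by (rule finite_subset[OF F finite_separated_sets])
  have finE: "finite D" "finite E0" "finite E1" "finite M"
    using fin by (auto simp: D_def E0_def E1_def M_def)
  have F_split: "F = E0 \<union> E1 \<union> D" "E0 \<inter> E1 = {}" "(E0 \<union> E1) \<inter> D = {}"
    by (auto simp: D_def E0_def E1_def)
  have F_sub: "A \<subseteq> {l..n}" if "A \<in> F" for A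
    using that F by (intro separated_sets_subset) blast
  have sep: "a + k < b" if "A \<in> F" "a \<in> A" "b \<in> A" "a < b" for A a b
    using F that separated_sets_sep by blast
  have no_Suc: "Suc l \<notin> A" if "A \<in> F" "l \<in> A" for A
    using sep[OF that(1,2), of "Suc l"] k by auto
  have g_first: "g ` A = insert (Suc l) (A - {l})" if "l \<in> A" for A
    using that by (auto simp: g_def)
  have g_other: "g ` A = A" if "l \<notin> A" for A
    using that by (auto simp: g_def)
  \<comment> \<open>Excluding \<open>l + k + 1\<close> gains one place:
    \<open>l + k + 2 = Suc l + k + 1\<close> is the left end that allows inserting
    \<open>Suc l\<close>.\<close>
  have E1_remove: "A - {l} \<in> separated_sets k n (l + k + 2) r" if "A \<in> E1" for A
  proof -
    have "A - {l} \<in> separated_sets k n (l + k + 1) r"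
      using that F by (intro separated_sets_remove_first) (auto simp: E1_def)
    moreover have "{l + k + 1..n} - {l + k + 1} \<subseteq> {l + k + 2..n}" by auto
    moreover have "l + k + 1 \<notin> A" using that by (simp add: E1_def)
    ultimately show ?thesis
      unfolding separated_sets_def by blast
  qed
  have g_E1: "g ` A \<in> separated_sets k n (Suc l) (Suc r)" if "A \<in> E1" for A
  proof -
    have "insert (Suc l) (A - {l}) \<in> separated_sets k n (Suc l) (Suc r)"
      using E1_remove[OF that] l by (intro separated_sets_insert_first) simp_all
    then show ?thesis using that g_first by (simp add: E1_def)
  qed
  have M_member: "\<exists>X. Y = insert (Suc l) X \<and> insert l X \<in> F \<and> Suc l \<notin> X \<and> l \<notin> X
      \<and> X \<in> separated_sets k n (l + k + 2) r" if "Y \<in> M" for Y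
  proof -
    from that obtain A where A: "A \<in> E1" "Y = g ` A" by (auto simp: M_def)
    then have "l \<in> A" "A \<in> F" by (auto simp: E1_def)
    then have "Y = insert (Suc l) (A - {l})" "insert l (A - {l}) \<in> F" "Suc l \<notin> A - {l}"
      using A(2) g_first no_Suc[of A] by (simp_all add: insert_absorb)
    then show ?thesis using E1_remove[OF A(1)] by blast
  qed
  have M_F: "Y \<in> F" if "Y \<in> M" for Y using that by (simp add: M_def E0_def)

  \<comment> \<open>On \<open>E1\<close> the contraction is undone by exchanging
    \<open>Suc l\<close> for \<open>l\<close>, so collisions occur only between \<open>E0\<close>
    and \<open>E1\<close>.\<close>
  have inj_g: "inj_on (image g) E1"
  proof (rule inj_onI)
    fix A A' assume A: "A \<in> E1" "A' \<in> E1" and eq: "g ` A = g ` A'"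
    have *: "l \<in> A" "l \<in> A'" "Suc l \<notin> A" "Suc l \<notin> A'"
      using A no_Suc by (auto simp: E1_def)
    then have "A = insert l (g ` A - {Suc l})" "A' = insert l (g ` A' - {Suc l})"
      by (auto simp: g_first)
    then show "A = A'" using eq by simp
  qed
  have card_B: "card B + card M = card E0 + card E1"
    using card_Un_Int[of E0 "image g ` E1"] finE card_image[OF inj_g]
    by (simp add: B_def M_def)
  have B_sub: "B \<subseteq> separated_sets k n (Suc l) (Suc r)"
  proof -
    have "A \<in> separated_sets k n (Suc l) (Suc r)" if "A \<in> E0" for A
    proof -
      have "A \<in> F" "l \<notin> A" using that by (auto simp: E0_def)
      moreover have "{l..n} - {l} \<subseteq> {Suc l..n}" by auto
      then have "A \<subseteq> {Suc l..n}"
        using F_sub[OF \<open>A \<in> F\<close>] \<open>l \<notin> A\<close> by blast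
      ultimately show ?thesis using F by (auto simp: separated_sets_def)
    qed
    then show ?thesis using g_E1 by (auto simp: B_def)
  qed
  \<comment> \<open>Since \<open>g\<close> fixes every set in \<open>E0\<close>, all of
    \<open>B\<close> consists of images of members of \<open>F\<close>, and the image of a common
    point is a common point.\<close>
  have B_int: "intersecting B"
  proof -
    have "image g ` E0 = E0" using g_other by (simp add: E0_def)
    then have "B = image g ` (E0 \<union> E1)" by (simp add: B_def image_Un)
    moreover have "E0 \<union> E1 \<subseteq> F" by (auto simp: E0_def E1_def)
    ultimately have B_image: "B \<subseteq> image g ` F" by blast
    show ?thesis
      unfolding intersecting_def
    proof (intro ballI)
      fix U V assume "U \<in> B" "V \<in> B"
      then obtain A A' where "A \<in> F" "A' \<in> F" "U = g ` A" "V = g ` A'"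
        using B_image by (metis imageE subsetD)
      moreover from this have "A \<inter> A' \<noteq> {}" using int by (simp add: intersecting_def)
      ultimately show "U \<inter> V \<noteq> {}" by blast
    qed
  qed

  have inj_M: "inj_on (\<lambda>A. A - {Suc l}) M"
  proof (rule inj_on_inverseI[where g = "insert (Suc l)"])
    fix Y assume "Y \<in> M"
    then show "insert (Suc l) (Y - {Suc l}) = Y" using M_member by blast
  qed
  have inj_D: "inj_on (\<lambda>A. A - {l}) D"
    by (rule inj_on_inverseI[where g = "insert l"]) (auto simp: D_def)
  have notin_M: "l + k + 1 \<notin> Y" if Y: "Y \<in> M" for Y
  proof -
    obtain X where X: "Y = insert (Suc l) X" "X \<in> separated_sets k n (l + k + 2) r"
      using M_member[OF Y] by blast
    then show ?thesis using separated_sets_subset[OF X(2)] k by auto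
  qed
  \<comment> \<open>The vertex \<open>l + k + 1\<close> tells the two kinds apart: it remains in
    every set coming from \<open>D\<close> and is in none coming from \<open>M\<close>.\<close>
  have disj: "(\<lambda>A. A - {Suc l}) ` M \<inter> (\<lambda>A. A - {l}) ` D = {}"
  proof -
    have "Y - {Suc l} \<noteq> A - {l}" if "Y \<in> M" "A \<in> D" for Y A
    proof
      assume "Y - {Suc l} = A - {l}"
      moreover have "l + k + 1 \<in> A - {l}" using that(2) by (simp add: D_def)
      ultimately show False using notin_M[OF that(1)] by blast
    qed
    then show ?thesis by blast
  qed
  have card_C: "card C = card M + card D"
    unfolding C_def using finE disj
    by (simp add: card_Un_disjoint card_image inj_M inj_D)
  have C_sub: "C \<subseteq> separated_sets k n (l + k + 1) r"
  proof -
    have "Y - {Suc l} \<in> separated_sets k n (l + k + 1) r" if Y: "Y \<in> M" for Y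
    proof -
      obtain X where "Y = insert (Suc l) X" "Suc l \<notin> X" "X \<in> separated_sets k n (l + k + 2) r"
        using M_member[OF Y] by blast
      then show ?thesis
        using separated_sets_mono[of "l + k + 1" "l + k + 2"] by auto
    qed
    moreover have "A - {l} \<in> separated_sets k n (l + k + 1) r" if "A \<in> D" for A
      using that F by (intro separated_sets_remove_first) (auto simp: D_def)
    ultimately show ?thesis by (auto simp: C_def)
  qed
  \<comment> \<open>\<open>Y\<close> misses \<open>l\<close> and \<open>A\<close> misses
    \<open>Suc l\<close>, so a common point is neither of the two and survives both
    deletions.\<close>
  have M_int: "(Y - {Suc l}) \<inter> (A - {l}) \<noteq> {}" if "Y \<in> M" "A \<in> F" "l \<in> A" for Y A
  proof -
    have "Y \<inter> A \<noteq> {}" using int M_F[OF that(1)] that(2) by (auto simp: intersecting_def)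
    moreover have "l \<notin> Y" using that(1) by (simp add: M_def E0_def)
    ultimately show ?thesis using no_Suc[OF that(2,3)] by blast
  qed
  have C_int: "intersecting C"
  proof -
    \<comment> \<open>\<open>Y\<close> and \<open>Z\<close> might share only \<open>Suc l\<close>.
      Replacing \<open>Z\<close> by its twin \<open>insert l X\<close> in \<open>F\<close> forces a
      common point inside \<open>X\<close>.\<close>
    have "(Y - {Suc l}) \<inter> (Z - {Suc l}) \<noteq> {}" if Y: "Y \<in> M" and Z: "Z \<in> M" for Y Z
    proof -
      obtain X where "Z = insert (Suc l) X" "insert l X \<in> F" "Suc l \<notin> X" "l \<notin> X"
        using M_member[OF Z] by blast
      then show ?thesis using M_int[OF Y, of "insert l X"] by simp
    qed
    moreover have "(Y - {Suc l}) \<inter> (A - {l}) \<noteq> {}" "(A - {l}) \<inter> (Y - {Suc l}) \<noteq> {}"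
      if "Y \<in> M" "A \<in> D" for Y A
      using M_int[of Y A] that by (auto simp: D_def)
    \<comment> \<open>Both sets retain \<open>l + k + 1\<close>.\<close>
    moreover have "(A - {l}) \<inter> (A' - {l}) \<noteq> {}" if "A \<in> D" "A' \<in> D" for A A'
      using that by (auto simp: D_def)
    ultimately show ?thesis
      unfolding intersecting_def C_def by (intro ballI) (elim UnE imageE, simp_all)
  qed
  have "card F = card E0 + card E1 + card D"
    using F_split finE by (simp add: card_Un_disjoint)
  then have "card F = card B + card C" using card_B card_C by simp
  then show ?thesis by (rule that[OF B_sub B_int C_sub C_int])
qed

text \<open>Induction on the number of vertices, with \<open>r\<close> and \<open>F\<close> general
  because \<open>C\<close> consists of smaller sets. Contraction bounds \<open>F\<close> by two
  families on shorter paths with the same end \<open>n\<close>, whose stars add up by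
  \<open>star_recursion\<close>.\<close>

lemma intersecting_separated_le_star:
  assumes k: "1 \<le> k"
  shows "F \<subseteq> separated_sets k n l r \<Longrightarrow> intersecting F \<Longrightarrow> 1 \<le> r
    \<Longrightarrow> card F \<le> card {A \<in> separated_sets k n l r. n \<in> A}"
proof (induction "Suc n - l" arbitrary: l r F rule: less_induct)
  case less
  consider "F = {}" | "F \<noteq> {}" "r = 1" | s where "F \<noteq> {}" "r = Suc s" "1 \<le> s"
    using less.prems(3) by (cases r) force+
  then show ?case
  proof cases
    case 1
    then show ?thesis by simp
  next
    case 2
    have singleton: "\<exists>y. A = {y}" if "A \<in> F" for A
      using less.prems(1) 2(2) that separated_sets_card card_1_singletonE by (metis subsetD)
    from 2 obtain A x where A: "A \<in> F" and x: "A = {x}" using singleton by blast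
    have "A' = {x}" if A': "A' \<in> F" for A'
    proof -
      obtain y where "A' = {y}" using singleton[OF A'] by blast
      moreover have "A \<inter> A' \<noteq> {}" using less.prems(2) A A' by (simp add: intersecting_def)
      ultimately show ?thesis using x by simp
    qed
    then have "card F \<le> card {{x}}" by (intro card_mono) auto
    also have "\<dots> = card {{n}}" by simp
    \<comment> \<open>From \<open>x \<in> {l..n}\<close> follows \<open>l \<le> n\<close>, so
      \<open>{n}\<close> itself lies in the star.\<close>
    also have "\<dots> \<le> card {A \<in> separated_sets k n l r. n \<in> A}"
      using A x less.prems(1) 2 by (intro card_mono) (auto simp: separated_sets_def)
    finally show ?thesis .
  next
    case 3
    then obtain A where A: "A \<in> separated_sets k n l r" using less.prems(1) by blast
    \<comment> \<open>A member has at least two elements, so the interval has at least two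
      vertices.\<close>
    then have "r \<le> card {l..n}"
      using card_mono[OF _ separated_sets_subset[OF A]] by (simp add: separated_sets_card)
    then have l: "l < n" using 3 by simp
    have F: "F \<subseteq> separated_sets k n l (Suc s)" using less.prems(1) 3 by simp
    obtain B C where BC: "B \<subseteq> separated_sets k n (Suc l) (Suc s)" "intersecting B"
      "C \<subseteq> separated_sets k n (l + k + 1) s" "intersecting C" "card F = card B + card C"
      using contraction_bound[OF k l F less.prems(2)] .
    have "card F \<le> card {A \<in> separated_sets k n (Suc l) (Suc s). n \<in> A}
        + card {A \<in> separated_sets k n (l + k + 1) s. n \<in> A}"
      unfolding BC(5) using l 3 by (intro add_mono less.hyps BC) auto
    also have "\<dots> \<le> card {A \<in> separated_sets k n l (Suc s). n \<in> A}"
      using l by (intro star_recursion) simp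
    finally show ?thesis using 3 by simp
  qed
qed

text \<open>The ends of an edge are distinct, so naming the smaller one first turns non-adjacency
  into \<open>a + k < b\<close>.\<close>

lemma indep_sets_path_power: "indep_sets (path_power n k) r = separated_sets k n 1 r"
proof -
  have "independent_set (path_power n k) A \<longleftrightarrow> (\<forall>a\<in>A. \<forall>b\<in>A. a < b \<longrightarrow> a + k < b)"
    if A: "A \<subseteq> {1..n}" for A
  proof
    assume ind: "independent_set (path_power n k) A"
    show "\<forall>a\<in>A. \<forall>b\<in>A. a < b \<longrightarrow> a + k < b"
    proof (intro ballI impI)
      fix a b assume ab: "a \<in> A" "b \<in> A" "a < b"
      then have "{a, b} \<notin> edges (path_power n k)"
        using ind by (auto simp: independent_set_def)
      then have "\<not> (1 \<le> \<bar>int a - int b\<bar> \<and> \<bar>int a - int b\<bar> \<le> int k)"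
        using ab A by (subst (asm) path_power_adjacent_iff) auto
      then show "a + k < b" using ab(3) by linarith
    qed
  next
    assume sep: "\<forall>a\<in>A. \<forall>b\<in>A. a < b \<longrightarrow> a + k < b"
    have "\<not> e \<subseteq> A" if "e \<in> edges (path_power n k)" for e
    proof
      assume "e \<subseteq> A"
      from that obtain a b where ab: "e = {a, b}" "1 \<le> \<bar>int a - int b\<bar>" "\<bar>int a - int b\<bar> \<le> int k"
        by (auto simp: path_power_def)
      then have "a \<in> A" "b \<in> A" "a < b \<or> b < a" using \<open>e \<subseteq> A\<close> by auto
      then have "a + k < b \<or> b + k < a" using sep by blast
      then show False using ab by linarith
    qed
    then show "independent_set (path_power n k) A"
      using A by (simp add: independent_set_def path_power_def)
  qed
  then show ?thesis
    by (auto simp: indep_sets_def separated_sets_def path_power_def)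
qed

theorem theorem5:
  fixes n k :: nat
  assumes "1 \<le> k" and "k \<le> n"
  shows "\<forall>r::nat. r \<ge> 1 \<longrightarrow> EKR r (path_power n k)"
  unfolding EKR_def
proof (intro allI impI, elim conjE)
  fix r :: nat and F
  assume r: "1 \<le> r" and F: "F \<subseteq> indep_sets (path_power n k) r" "intersecting F"
  have "card F \<le> card (star (path_power n k) r n)"
    using intersecting_separated_le_star[OF assms(1), of F n 1 r] r F
    by (simp add: star_def indep_sets_path_power)
  \<comment> \<open>\<open>1 \<le> k \<le> n\<close> makes \<open>n\<close> a vertex, so its star is
    among those compared.\<close>
  also have "\<dots> \<le> Max ((\<lambda>v. card (star (path_power n k) r v)) ` verts (path_power n k))"
    using assms by (intro Max_ge imageI) (simp_all add: path_power_def)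
  finally show "card F \<le> Max ((\<lambda>v. card (star (path_power n k) r v)) ` verts (path_power n k))" .
qed

end
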